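(* Let $\mathcal{U}=\{\pmb{c}^1,\ldots,\pmb{c}^N\}\subseteq\mathbb{R}^n_+$ and let $K\ge 1$ be an integer. Let $t>0$, $(\lambda_{ki})_{k\in[K],i\in[N]}$ and $(\mu_{ik})_{i\in[N],k\in[K]}$ be a feasible solution of the problem $$\begin{aligned}\max\ & t\\ \text{s.t. } & t c^i_j\le\sum_{k\in[K]}\sum_{\ell\in[N]}\mu_{ik}\lambda_{k\ell}c^\ell_j && \forall i\in[N],\,j\in[n]\\ & \sum_{i\in[N]}\lambda_{ki}=1 && \forall k\in[K]\\ & \sum_{k\in[K]}\mu_{ik}=1 && \forall i\in[N]\\ & t\ge 0,\quad \lambda_{ki}\ge 0,\quad \mu_{ik}\ge 0 && \forall i\in[N],\,k\in[K].\end{aligned}$$ Define the reduced scenario set $\mathcal{C}=\{\hat{\pmb{c}}^1,\ldots,\hat{\pmb{c}}^K\}$ by $\hat{c}^k_j=\sum_{i\in[N]}\lambda_{ki}c^i_j$ for $k\in[K]$, $j\in[n]$. Then, for every feasible set $\mathcal{X}\subseteq\mathbb{R}^n_+$, any optimal solution to the one-stage robust optimization problem with respect to $\mathcal{C}$ is a $1/t$-approximation to the one-stage robust optimization problem with respect to $\mathcal{U}$.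
   Context: $[N]=\{1,\ldots,N\}$; $\mathbb{R}^n_+$ is the set of vectors in $\mathbb{R}^n$ with nonnegative entries; $c^i_j$ is the $j$-th entry of $\pmb{c}^i$. Given a set of feasible solutions $\mathcal{X}\subseteq\mathbb{R}^n_+$ and a finite nonempty set $\mathcal{V}\subseteq\mathbb{R}^n_+$, the one-stage robust optimization problem with respect to $\mathcal{V}$ is $\min_{\pmb{x}\in\mathcal{X}}\max_{\pmb{c}\in\mathcal{V}}\pmb{c}^\intercal\pmb{x}$. For $\rho\ge 0$, a solution $\hat{\pmb{x}}\in\mathcal{X}$ is a $\rho$-approximation to the problem with respect to $\mathcal{U}$ if $\max_{\pmb{c}\in\mathcal{U}}\pmb{c}^\intercal\hat{\pmb{x}}\le\rho\cdot\min_{\pmb{x}\in\mathcal{X}}\max_{\pmb{c}\in\mathcal{U}}\pmb{c}^\intercal\pmb{x}$, where (as throughout) the minima that are written are assumed to be attained. *)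

theory Defs
  imports "HOL-Analysis.Analysis"
begin

definition nonneg_orthant :: "(real ^ 'n) set" where
  "nonneg_orthant = {x. \<forall>j. 0 \<le> x $ j}"

text \<open>Only meaningful for finite nonempty \<open>V\<close>, like \<^const>\<open>Max\<close>.\<close>

definition worst_case_cost :: "(real ^ 'n) set \<Rightarrow> real ^ 'n \<Rightarrow> real" where
  "worst_case_cost V x = Max ((\<lambda>c. c \<bullet> x) ` V)"

definition robust_optimal ::
  "(real ^ 'n) set \<Rightarrow> (real ^ 'n) set \<Rightarrow> real ^ 'n \<Rightarrow> bool" where
  "robust_optimal X V x \<longleftrightarrow> is_arg_min (worst_case_cost V) (\<lambda>y. y \<in> X) x"

text \<open>The minimum itself, not an infimum: the value is unspecified unless the minimum is attained.\<close>

definition robust_value :: "(real ^ 'n) set \<Rightarrow> (real ^ 'n) set \<Rightarrow> real" where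
  "robust_value X V = (LEAST v. v \<in> worst_case_cost V ` X)"

definition robust_approximation ::
  "real \<Rightarrow> (real ^ 'n) set \<Rightarrow> (real ^ 'n) set \<Rightarrow> real ^ 'n \<Rightarrow> bool" where
  "robust_approximation \<rho> X V x \<longleftrightarrow>
     x \<in> X \<and> worst_case_cost V x \<le> \<rho> * robust_value X V"

text \<open>
  Scenarios are \<open>c 1, \<dots>, c N\<close>; values of \<open>c\<close>, \<open>lam\<close>, \<open>mu\<close> outside the index ranges
  \<open>{1..N}\<close> and \<open>{1..K}\<close> are irrelevant.
\<close>

definition reduction_feasible ::
  "nat \<Rightarrow> nat \<Rightarrow> (nat \<Rightarrow> real ^ 'n) \<Rightarrow> real \<Rightarrow> (nat \<Rightarrow> nat \<Rightarrow> real) \<Rightarrow> (nat \<Rightarrow> nat \<Rightarrow> real) \<Rightarrow> bool"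
where
  "reduction_feasible N K c t lam mu \<longleftrightarrow>
     (\<forall>i\<in>{1..N}. \<forall>j. t * c i $ j \<le> (\<Sum>k=1..K. \<Sum>l=1..N. mu i k * lam k l * c l $ j)) \<and>
     (\<forall>k\<in>{1..K}. (\<Sum>i=1..N. lam k i) = 1) \<and>
     (\<forall>i\<in>{1..N}. (\<Sum>k=1..K. mu i k) = 1) \<and>
     0 \<le> t \<and>
     (\<forall>i\<in>{1..N}. \<forall>k\<in>{1..K}. 0 \<le> lam k i \<and> 0 \<le> mu i k)"

definition reduced_scenario ::
  "nat \<Rightarrow> (nat \<Rightarrow> real ^ 'n) \<Rightarrow> (nat \<Rightarrow> nat \<Rightarrow> real) \<Rightarrow> nat \<Rightarrow> real ^ 'n" where
  "reduced_scenario N c lam k = (\<chi> j. \<Sum>i=1..N. lam k i * c i $ j)"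

end

theory Submission
  imports Defs
begin

text \<open>
  The worst-case cost of a fixed \<open>x \<ge> 0\<close> is the maximum of a linear function of the scenario,
  monotone in each entry of the scenario. Hence it cannot be exceeded by a scenario that is dominated
  entrywise by a convex combination of the given ones. This is applied twice.

  Each reduced scenario is a convex combination (weights \<open>lam k\<close>) of scenarios in \<open>U\<close>, so
  the worst case over \<open>C\<close> is at most the worst case over \<open>U\<close>. Conversely, the first constraint
  says that \<open>t *\<^sub>R c i\<close> is dominated by a convex combination (weights \<open>mu i\<close>) of reduced
  scenarios, so \<open>t\<close> times the worst case over \<open>U\<close> is at most the worst case over \<open>C\<close>.
  If \<open>x\<close> is optimal for \<open>C\<close> and \<open>y\<close> for \<open>U\<close>, the two bounds and the
  optimality of \<open>x\<close> give
  \<open>t * worst_case_cost U x \<le> worst_case_cost C x \<le> worst_case_cost C y \<le> worst_case_cost U y\<close>,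
  and the last term is the optimal value for \<open>U\<close>.
\<close>

lemma worst_case_cost_le_iff:
  assumes "finite V" and "V \<noteq> {}"
  shows "worst_case_cost V x \<le> m \<longleftrightarrow> (\<forall>c\<in>V. c \<bullet> x \<le> m)"
  using assms by (simp add: worst_case_cost_def)

lemma cost_le_worst_case_cost:
  assumes "finite V" and "c \<in> V"
  shows "c \<bullet> x \<le> worst_case_cost V x"
  using assms by (simp add: worst_case_cost_def)

lemma inner_mono_nonneg_orthant:
  assumes "x \<in> nonneg_orthant" and "\<And>j. a $ j \<le> b $ j"
  shows "a \<bullet> x \<le> b \<bullet> x"
  using assms by (auto simp: nonneg_orthant_def inner_vec_def intro!: sum_mono mult_right_mono)

text \<open>The cost of a convex combination is a weighted average of costs, each bounded by the maximum.\<close>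

lemma convex_combination_cost_le_worst_case_cost:
  assumes "finite V" and "\<And>i. i \<in> I \<Longrightarrow> v i \<in> V"
    and "\<And>i. i \<in> I \<Longrightarrow> 0 \<le> w i" and "(\<Sum>i\<in>I. w i) = 1"
  shows "(\<Sum>i\<in>I. w i *\<^sub>R v i) \<bullet> x \<le> worst_case_cost V x"
proof -
  have "(\<Sum>i\<in>I. w i *\<^sub>R v i) \<bullet> x = (\<Sum>i\<in>I. w i * (v i \<bullet> x))"
    by (simp add: inner_sum_left)
  also have "\<dots> \<le> (\<Sum>i\<in>I. w i * worst_case_cost V x)"
    using assms by (intro sum_mono mult_left_mono cost_le_worst_case_cost)
  also have "\<dots> = worst_case_cost V x"
    using assms(4) by (simp flip: sum_distrib_right)
  finally show ?thesis .
qed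

lemma reduced_scenario_eq_sum:
  "reduced_scenario N c lam k = (\<Sum>i=1..N. lam k i *\<^sub>R c i)"
  by (simp add: reduced_scenario_def vec_eq_iff)

lemma worst_case_cost_reduced_le:
  assumes "K \<ge> 1" and "reduction_feasible N K c t lam mu"
  shows "worst_case_cost (reduced_scenario N c lam ` {1..K}) x \<le> worst_case_cost (c ` {1..N}) x"
proof -
  have "reduced_scenario N c lam k \<bullet> x \<le> worst_case_cost (c ` {1..N}) x" if "k \<in> {1..K}" for k
    unfolding reduced_scenario_eq_sum
    using assms(2) that
    by (intro convex_combination_cost_le_worst_case_cost) (auto simp: reduction_feasible_def)
  then show ?thesis
    using assms(1) by (subst worst_case_cost_le_iff) auto
qed

text \<open>
  Pulling \<open>mu i k\<close> out of the inner sum of the first constraint exhibits its right-hand side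
  as the convex combination of the reduced scenarios with weights \<open>mu i\<close>.
\<close>

lemma scaled_worst_case_cost_le_reduced:
  assumes "N \<ge> 1" and "t > 0" and feasible: "reduction_feasible N K c t lam mu"
    and x: "x \<in> nonneg_orthant"
  shows "t * worst_case_cost (c ` {1..N}) x \<le> worst_case_cost (reduced_scenario N c lam ` {1..K}) x"
    (is "_ \<le> ?M")
proof -
  have "t * (c i \<bullet> x) \<le> ?M" if i: "i \<in> {1..N}" for i
  proof -
    have "(t *\<^sub>R c i) $ j \<le> (\<Sum>k=1..K. mu i k *\<^sub>R reduced_scenario N c lam k) $ j" for j
      using feasible i
      by (simp add: reduction_feasible_def reduced_scenario_def sum_distrib_left mult.assoc)
    from inner_mono_nonneg_orthant[OF x this]
    have "(t *\<^sub>R c i) \<bullet> x \<le> (\<Sum>k=1..K. mu i k *\<^sub>R reduced_scenario N c lam k) \<bullet> x" .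
    also have "\<dots> \<le> ?M"
      using feasible i
      by (intro convex_combination_cost_le_worst_case_cost) (auto simp: reduction_feasible_def)
    finally show ?thesis by simp
  qed
  then have "worst_case_cost (c ` {1..N}) x \<le> ?M / t"
    using assms(1,2) by (subst worst_case_cost_le_iff) (auto simp: field_simps)
  then show ?thesis
    using assms(2) by (simp add: field_simps)
qed

lemma robust_optimal_iff:
  "robust_optimal X V x \<longleftrightarrow> x \<in> X \<and> (\<forall>y\<in>X. worst_case_cost V x \<le> worst_case_cost V y)"
  by (auto simp: robust_optimal_def is_arg_min_linorder)

lemma robust_value_eq:
  assumes "robust_optimal X V y"
  shows "robust_value X V = worst_case_cost V y"
  unfolding robust_value_def
  using assms by (intro Least_equality) (auto simp: robust_optimal_iff)

theorem corollary4:
  fixes N K :: nat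
    and c :: "nat \<Rightarrow> real ^ 'n"
    and t :: real
    and lam mu :: "nat \<Rightarrow> nat \<Rightarrow> real"
    and U C X :: "(real ^ 'n) set"
    and x :: "real ^ 'n"
  assumes "N \<ge> 1" and "K \<ge> 1"
    and "U = c ` {1..N}" and "U \<subseteq> nonneg_orthant"
    and "t > 0" and "reduction_feasible N K c t lam mu"
    and "C = reduced_scenario N c lam ` {1..K}"
    and "X \<subseteq> nonneg_orthant"
    and "\<exists>y. robust_optimal X U y"
    and "robust_optimal X C x"
  shows "robust_approximation (1 / t) X U x"
proof -
  obtain y where y: "robust_optimal X U y"
    using assms(9) by blast
  have xX: "x \<in> X" and yX: "y \<in> X"
    using y assms(10) by (simp_all add: robust_optimal_iff)
  have "t * worst_case_cost U x \<le> worst_case_cost C x"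
    unfolding \<open>U = _\<close> \<open>C = _\<close>
    using \<open>X \<subseteq> nonneg_orthant\<close> xX
    by (intro scaled_worst_case_cost_le_reduced[OF assms(1,5,6)]) (rule subsetD)
  also have "\<dots> \<le> worst_case_cost C y"
    using assms(10) yX by (simp add: robust_optimal_iff)
  also have "\<dots> \<le> worst_case_cost U y"
    unfolding \<open>U = _\<close> \<open>C = _\<close> by (rule worst_case_cost_reduced_le[OF assms(2,6)])
  also have "\<dots> = robust_value X U"
    using robust_value_eq[OF y] by simp
  finally show ?thesis
    using xX \<open>t > 0\<close> by (simp add: robust_approximation_def field_simps)
qed

end
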